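(* Fix an integer $k\ge2$ and a constant $c\ge1$. There do not exist a (possibly randomized) algorithm for Learn-Median and a function $h$ with $h(k,\Delta)/(k\Delta)\to0$ as $\Delta\to\infty$, such that for every finite metric space $(V,d)$ with aspect ratio $\Delta$, every $T$, every sequence $V_0,\dots,V_T$ of instances, and every $Y\subseteq V$ with $|Y|=k$, \[ \sum_{t=1}^T\mathbb{E}[\rho(Y_t,V_t)]\le c\sum_{t=1}^T\rho(Y,V_t)+h(k,\Delta), \] where $Y_t$ is the algorithm's output at time $t$.
   Context: Learn-Median: $(V,d)$ is a finite metric space scaled so that $\min_{x\neq y}d(x,y)=1$, and $\Delta=\max_{x,y}d(x,y)$. A sequence of instances $V_0,\dots,V_T\subseteq V$, each with at least $k+1$ distinct points, arrives online; at each time $t\ge1$, knowing $V_0,\dots,V_{t-1}$ but not $V_t$, the algorithm outputs a set $Y_t\subseteq V_0\cup\dots\cup V_{t-1}$ of $k$ points. For a set $Y$, $D(Y,x)=\min_{y\in Y}d(x,y)$, $\mathrm{Cost}_t(Y)=\sum_{x\in V_t}D(Y,x)$, $\mathrm{OPT}_t=\min_{Y\subseteq V,|Y|=k}\mathrm{Cost}_t(Y)$, $\rho(Y,V_t)=\mathrm{Cost}_t(Y)/\mathrm{OPT}_t$. *)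

theory Defs
  imports "HOL-Probability.Probability"
begin

definition scaled_metric_space :: "'a set \<Rightarrow> ('a \<Rightarrow> 'a \<Rightarrow> real) \<Rightarrow> bool" where
  "scaled_metric_space V d \<longleftrightarrow>
     finite V \<and> 2 \<le> card V \<and> Metric_space V d \<and>
     Min {d x y | x y. x \<in> V \<and> y \<in> V \<and> x \<noteq> y} = 1"

text \<open>Since the minimum distance is scaled to 1, the aspect ratio is the maximum distance.\<close>

definition aspect_ratio :: "'a set \<Rightarrow> ('a \<Rightarrow> 'a \<Rightarrow> real) \<Rightarrow> real" where
  "aspect_ratio V d = Max {d x y | x y. x \<in> V \<and> y \<in> V}"

definition D :: "('a \<Rightarrow> 'a \<Rightarrow> real) \<Rightarrow> 'a set \<Rightarrow> 'a \<Rightarrow> real" where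
  "D d Y x = Min {d x y | y. y \<in> Y}"

definition Cost :: "('a \<Rightarrow> 'a \<Rightarrow> real) \<Rightarrow> 'a set \<Rightarrow> 'a set \<Rightarrow> real" where
  "Cost d X Y = (\<Sum>x\<in>X. D d Y x)"

definition OPT :: "nat \<Rightarrow> 'a set \<Rightarrow> ('a \<Rightarrow> 'a \<Rightarrow> real) \<Rightarrow> 'a set \<Rightarrow> real" where
  "OPT k V d X = Min {Cost d X Y | Y. Y \<subseteq> V \<and> card Y = k}"

definition rho :: "nat \<Rightarrow> 'a set \<Rightarrow> ('a \<Rightarrow> 'a \<Rightarrow> real) \<Rightarrow> 'a set \<Rightarrow> 'a set \<Rightarrow> real" where
  "rho k V d Y X = Cost d X Y / OPT k V d X"

definition median_instance :: "nat \<Rightarrow> 'a set \<Rightarrow> 'a set \<Rightarrow> bool" where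
  "median_instance k V X \<longleftrightarrow> X \<subseteq> V \<and> k + 1 \<le> card X"

text \<open>
  A randomized online algorithm is a random choice of a deterministic one: a seed \<open>\<omega>\<close> is drawn
  from a probability space \<open>M\<close>, and \<open>A \<omega> V d [V\<^sub>0, \<dots>, V\<^sub>t\<^sub>-\<^sub>1]\<close> is the output at time \<open>t \<ge> 1\<close>.
  Outputs at different times share the seed and may thus be arbitrarily correlated; past outputs
  are determined by the seed and the history. The algorithm knows the ambient metric space but
  neither \<open>V\<^sub>t\<close> nor the horizon, and no computability is demanded, so that ruling out these
  algorithms also rules out those that learn distances only between revealed points.
\<close>

type_synonym ('w, 'a) online_algorithm =
  "'w \<Rightarrow> 'a set \<Rightarrow> ('a \<Rightarrow> 'a \<Rightarrow> real) \<Rightarrow> 'a set list \<Rightarrow> 'a set"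

definition learn_median_algorithm ::
    "nat \<Rightarrow> 'w measure \<Rightarrow> ('w, 'a) online_algorithm \<Rightarrow> bool" where
  "learn_median_algorithm k M A \<longleftrightarrow>
     prob_space M \<and>
     (\<forall>V d Vs. scaled_metric_space V d \<and> Vs \<noteq> [] \<and> (\<forall>X\<in>set Vs. median_instance k V X) \<longrightarrow>
        (\<lambda>\<omega>. A \<omega> V d Vs) \<in> measurable M (count_space UNIV) \<and>
        (\<forall>\<omega>\<in>space M. A \<omega> V d Vs \<subseteq> \<Union>(set Vs) \<and> card (A \<omega> V d Vs) = k))"

end

(* Learned centres must be points already revealed, so a single step suffices: let V_0 and V_1 be two
   cliques of k + 1 points at mutual distance 1, placed at distance Delta from each other. Every
   algorithm pays (k + 1) * Delta on V_1, while k points of V_1 pay 1 = OPT_1. Hence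
   h(k, Delta) >= (k + 1) * Delta - c. *)
theory Submission imports Defs begin

text \<open>The second cluster is the complement of \<open>P\<close>, so the distance is defined on
  the whole type and restricts to any ambient set \<open>V\<close>.\<close>

definition two_cluster_dist :: "'a set \<Rightarrow> real \<Rightarrow> 'a \<Rightarrow> 'a \<Rightarrow> real" where
  "two_cluster_dist P \<Delta> x y =
     (if x = y then 0 else if x \<in> P \<longleftrightarrow> y \<in> P then 1 else \<Delta>)"

text \<open>Two kinds of triangle matter: a detour through the opposite side gives
  \<open>1 \<le> \<Delta> + \<Delta>\<close>, and a path that crosses once gives
  \<open>\<Delta> \<le> 1 + \<Delta>\<close>.\<close>

lemma Metric_space_two_cluster_dist:
  assumes "1 \<le> \<Delta>"
  shows "Metric_space V (two_cluster_dist P \<Delta>)"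
  using assms by unfold_locales (auto simp: two_cluster_dist_def split: if_splits)

text \<open>Two points inside \<open>P\<close> realise the distance 1, and
  \<open>1 \<le> \<Delta>\<close> keeps crossing pairs from undercutting it.\<close>

lemma scaled_metric_space_two_cluster_dist:
  assumes "1 \<le> \<Delta>" "finite V" "P \<subseteq> V" "2 \<le> card P"
  shows "scaled_metric_space V (two_cluster_dist P \<Delta>)"
proof -
  let ?d = "two_cluster_dist P \<Delta>"
  let ?S = "{?d x y | x y. x \<in> V \<and> y \<in> V \<and> x \<noteq> y}"
  have sub: "?S \<subseteq> {1, \<Delta>}"
    by (auto simp: two_cluster_dist_def)
  obtain p q where "p \<in> P" "q \<in> P" "p \<noteq> q"
    using assms(4) by (auto simp: numeral_2_eq_2 card_le_Suc_iff)
  then have "1 \<in> ?S"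
    using assms(3) by (force simp: two_cluster_dist_def)
  moreover have "finite ?S"
    by (rule finite_subset[OF sub]) simp
  moreover have "1 \<le> y" if "y \<in> ?S" for y
    using subsetD[OF sub that] assms(1) by auto
  ultimately have "Min ?S = 1"
    by (intro Min_eqI)
  moreover have "2 \<le> card V"
    using assms card_mono le_trans by blast
  ultimately show ?thesis
    using assms Metric_space_two_cluster_dist by (auto simp: scaled_metric_space_def)
qed

lemma aspect_ratio_two_cluster_dist:
  assumes "1 \<le> \<Delta>" "p \<in> P" "q \<notin> P" "p \<in> V" "q \<in> V"
  shows "aspect_ratio V (two_cluster_dist P \<Delta>) = \<Delta>"
proof -
  let ?d = "two_cluster_dist P \<Delta>"
  let ?S = "{?d x y | x y. x \<in> V \<and> y \<in> V}"
  have sub: "?S \<subseteq> {0, 1, \<Delta>}"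
    by (auto simp: two_cluster_dist_def)
  have "?d p q = \<Delta>"
    using assms by (auto simp: two_cluster_dist_def)
  then have "\<Delta> \<in> ?S"
    using assms(4,5) by (intro CollectI exI[of _ p] exI[of _ q]) simp
  moreover have "finite ?S"
    by (rule finite_subset[OF sub]) simp
  moreover have "y \<le> \<Delta>" if "y \<in> ?S" for y
    using subsetD[OF sub that] assms(1) by auto
  ultimately show ?thesis
    unfolding aspect_ratio_def by (intro Max_eqI)
qed

lemma D_eqI:
  assumes "finite Y" "y \<in> Y" "\<And>z. z \<in> Y \<Longrightarrow> d x y \<le> d x z"
  shows "D d Y x = d x y"
  unfolding D_def using assms by (intro Min_eqI) (auto simp: setcompr_eq_image)

text \<open>This is the price of being confined to revealed points: with every centre on the wrong
  side, each point of \<open>X\<close> pays the full \<open>\<Delta>\<close>, whichever centres are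
  chosen.\<close>

lemma Cost_two_cluster_dist_far:
  assumes "finite Y" "Y \<noteq> {}" "Y \<subseteq> P" "X \<inter> P = {}"
  shows "Cost (two_cluster_dist P \<Delta>) X Y = real (card X) * \<Delta>"
proof -
  let ?d = "two_cluster_dist P \<Delta>"
  obtain y where y: "y \<in> Y" using assms(2) by blast
  have far: "?d x z = \<Delta>" if "x \<in> X" "z \<in> Y" for x z
    using that assms(3,4) by (auto simp: two_cluster_dist_def)
  have "D ?d Y x = \<Delta>" if "x \<in> X" for x
    using D_eqI[OF assms(1) y, of ?d x] far[OF that] y by simp
  then show ?thesis
    by (simp add: Cost_def)
qed

lemma D_two_cluster_dist_self:
  assumes "0 \<le> \<Delta>" "finite Y" "x \<in> Y"
  shows "D (two_cluster_dist P \<Delta>) Y x = 0"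
  using D_eqI[OF assms(2,3), of "two_cluster_dist P \<Delta>" x] assms(1)
  by (simp add: two_cluster_dist_def)

lemma D_two_cluster_dist_nonneg:
  assumes "0 \<le> \<Delta>" "finite Y" "Y \<noteq> {}"
  shows "0 \<le> D (two_cluster_dist P \<Delta>) Y x"
  unfolding D_def using assms
  by (subst Min_ge_iff) (auto simp: setcompr_eq_image two_cluster_dist_def)

lemma D_two_cluster_dist_ge_1:
  assumes "1 \<le> \<Delta>" "finite Y" "Y \<noteq> {}" "x \<notin> Y"
  shows "1 \<le> D (two_cluster_dist P \<Delta>) Y x"
  unfolding D_def using assms
  by (subst Min_ge_iff) (auto simp: setcompr_eq_image two_cluster_dist_def)

text \<open>Pigeonhole: some point of \<open>X\<close> is not a centre and pays at least 1, while
  the other summands are nonnegative.\<close>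

lemma Cost_two_cluster_dist_ge_1:
  assumes "1 \<le> \<Delta>" "finite X" "finite Y" "Y \<noteq> {}" "card Y < card X"
  shows "1 \<le> Cost (two_cluster_dist P \<Delta>) X Y"
proof -
  obtain x where x: "x \<in> X" "x \<notin> Y"
    using assms(3,5) by (meson card_mono leD subsetI)
  have "1 \<le> D (two_cluster_dist P \<Delta>) Y x"
    using assms x by (intro D_two_cluster_dist_ge_1)
  also have "\<dots> \<le> Cost (two_cluster_dist P \<Delta>) X Y"
    unfolding Cost_def using assms x
    by (intro member_le_sum D_two_cluster_dist_nonneg) auto
  finally show ?thesis .
qed

text \<open>Only the removed point pays, and its nearest centre lies on its own side. This set
  serves both as the optimum and as the comparator.\<close>

lemma Cost_two_cluster_dist_remove:
  assumes "1 \<le> \<Delta>" "finite X" "X \<inter> P = {}" "x \<in> X" "X - {x} \<noteq> {}"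
  shows "Cost (two_cluster_dist P \<Delta>) X (X - {x}) = 1"
proof -
  let ?d = "two_cluster_dist P \<Delta>"
  obtain y where y: "y \<in> X - {x}" using assms(5) by blast
  have near: "?d x z = 1" if "z \<in> X - {x}" for z
    using that assms(3,4) by (auto simp: two_cluster_dist_def)
  then have "D ?d (X - {x}) x = 1"
    using D_eqI[OF _ y, of ?d x] assms(2) y by simp
  moreover have "D ?d (X - {x}) z = 0" if "z \<in> X - {x}" for z
    using that assms by (intro D_two_cluster_dist_self) auto
  ultimately show ?thesis
    unfolding Cost_def using assms(2,4) by (simp add: sum.remove[of X x])
qed

lemma OPT_two_cluster_dist:
  assumes "1 \<le> \<Delta>" "finite V" "X \<subseteq> V" "X \<inter> P = {}" "card X = k + 1" "1 \<le> k"
  shows "OPT k V (two_cluster_dist P \<Delta>) X = 1"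
  unfolding OPT_def
proof (rule Min_eqI)
  let ?S = "{Cost (two_cluster_dist P \<Delta>) X Y | Y. Y \<subseteq> V \<and> card Y = k}"
  have fin: "finite X" using assms(2,3) finite_subset by blast
  have "?S \<subseteq> Cost (two_cluster_dist P \<Delta>) X ` Pow V" by blast
  then show "finite ?S"
    using assms(2) by (auto intro: finite_subset)
  show "1 \<le> y" if y: "y \<in> ?S" for y
  proof -
    obtain Y where Y: "y = Cost (two_cluster_dist P \<Delta>) X Y" "Y \<subseteq> V" "card Y = k"
      using y by blast
    then show ?thesis
      using assms fin by (auto intro!: Cost_two_cluster_dist_ge_1 intro: finite_subset)
  qed
  obtain x where x: "x \<in> X"
    using assms(5) by fastforce
  then have "card (X - {x}) = k"
    using assms(5) fin by simp
  \<comment> \<open>The removed point must keep a neighbour as centre; for an empty set of centres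
    \<open>D\<close> would be an unspecified \<open>Min {}\<close>.\<close>
  moreover from this have "X - {x} \<noteq> {}"
    using assms(6) by (metis card.empty not_one_le_zero)
  then have "Cost (two_cluster_dist P \<Delta>) X (X - {x}) = 1"
    using assms fin x by (intro Cost_two_cluster_dist_remove)
  ultimately show "1 \<in> ?S"
    using assms(3) by (auto intro!: exI[of _ "X - {x}"])
qed

theorem theorem7:
  fixes k :: nat and c :: real
  assumes "k \<ge> 2" and "c \<ge> 1"
    and "infinite (UNIV :: 'a set)"
  shows "\<not> (\<exists>(M :: 'w measure) (A :: ('w, 'a) online_algorithm) (h :: nat \<Rightarrow> real \<Rightarrow> real).
    learn_median_algorithm k M A \<and>
    ((\<lambda>\<Delta>. h k \<Delta> / (real k * \<Delta>)) \<longlongrightarrow> 0) at_top \<and>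
    (\<forall>(V :: 'a set) (d :: 'a \<Rightarrow> 'a \<Rightarrow> real) (\<Delta> :: real) (T :: nat) (Vs :: nat \<Rightarrow> 'a set) (Y :: 'a set).
       scaled_metric_space V d \<and> aspect_ratio V d = \<Delta> \<and>
       (\<forall>t\<le>T. median_instance k V (Vs t)) \<and> Y \<subseteq> V \<and> card Y = k \<longrightarrow>
       (\<Sum>t = 1..T. prob_space.expectation M (\<lambda>\<omega>. rho k V d (A \<omega> V d (map Vs [0..<t])) (Vs t)))
         \<le> c * (\<Sum>t = 1..T. rho k V d Y (Vs t)) + h k \<Delta>))"
proof safe
  fix M :: "'w measure" and A :: "('w, 'a) online_algorithm" and h :: "nat \<Rightarrow> real \<Rightarrow> real"
  assume alg: "learn_median_algorithm k M A"
    and lim: "((\<lambda>\<Delta>. h k \<Delta> / (real k * \<Delta>)) \<longlongrightarrow> 0) at_top"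
    and bound: "\<forall>(V :: 'a set) (d :: 'a \<Rightarrow> 'a \<Rightarrow> real) (\<Delta> :: real) (T :: nat)
       (Vs :: nat \<Rightarrow> 'a set) (Y :: 'a set).
       scaled_metric_space V d \<and> aspect_ratio V d = \<Delta> \<and>
       (\<forall>t\<le>T. median_instance k V (Vs t)) \<and> Y \<subseteq> V \<and> card Y = k \<longrightarrow>
       (\<Sum>t = 1..T. prob_space.expectation M (\<lambda>\<omega>. rho k V d (A \<omega> V d (map Vs [0..<t])) (Vs t)))
         \<le> c * (\<Sum>t = 1..T. rho k V d Y (Vs t)) + h k \<Delta>"
  interpret prob_space M
    using alg by (simp add: learn_median_algorithm_def)
  \<comment> \<open>The two clusters are chosen once; below only the distance between them varies
    with \<open>\<Delta>\<close>.\<close>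
  obtain P :: "'a set" where P: "finite P" "card P = k + 1"
    using infinite_arbitrarily_large[OF assms(3)] by blast
  have "infinite (UNIV - P)"
    using assms(3) P(1) by (rule Diff_infinite_finite[rotated])
  then obtain X where X: "finite X" "card X = k + 1" "X \<inter> P = {}"
    using infinite_arbitrarily_large[of "UNIV - P" "k + 1"] by blast
  obtain p x where px: "p \<in> P" "x \<in> X"
    using P(2) X(2) by fastforce
  have px': "x \<notin> P" using px X(3) by blast
  have card_Y: "card (X - {x}) = k" using X px by simp
  then have Y_ne: "X - {x} \<noteq> {}" using assms(1) by (metis card.empty not_numeral_le_zero)
  define V where "V = P \<union> X"
  have lower: "real (k + 1) * \<Delta> - c \<le> h k \<Delta>" if \<Delta>: "1 \<le> \<Delta>" for \<Delta>
  proof -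
    define d where "d = two_cluster_dist P \<Delta>"
    \<comment> \<open>The horizon will be 1, so only the values at times 0 and 1 matter.\<close>
    define Vs where "Vs t = (if t = 0 then P else X)" for t :: nat
    have scaled: "scaled_metric_space V d"
      unfolding d_def V_def using \<Delta> P X assms(1)
      by (intro scaled_metric_space_two_cluster_dist) auto
    have "aspect_ratio V d = \<Delta>"
      unfolding d_def V_def using \<Delta> px px' by (intro aspect_ratio_two_cluster_dist) auto
    moreover have inst: "median_instance k V (Vs t)" for t
      using P X by (auto simp: median_instance_def Vs_def V_def)
    ultimately have le: "expectation (\<lambda>\<omega>. rho k V d (A \<omega> V d [P]) X)
        \<le> c * rho k V d (X - {x}) X + h k \<Delta>"
      \<comment> \<open>For \<open>T = 1\<close> both sums have a single term, and the history
        before time 1 is \<open>[P]\<close>.\<close>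
      using bound[rule_format, of V d \<Delta> 1 Vs "X - {x}"] scaled card_Y
      by (auto simp: Vs_def V_def)
    have opt: "OPT k V d X = 1"
      unfolding d_def V_def using \<Delta> P X assms(1) by (intro OPT_two_cluster_dist) auto
    have out: "A \<omega> V d [P] \<subseteq> P \<and> card (A \<omega> V d [P]) = k" if "\<omega> \<in> space M" for \<omega>
    proof -
      have "scaled_metric_space V d \<and> [P] \<noteq> [] \<and> (\<forall>X\<in>set [P]. median_instance k V X)"
        using scaled inst[of 0] by (simp add: Vs_def)
      then have "A \<omega> V d [P] \<subseteq> \<Union>(set [P]) \<and> card (A \<omega> V d [P]) = k"
        using alg that unfolding learn_median_algorithm_def by blast
      then show ?thesis by simp
    qed
    have "rho k V d (A \<omega> V d [P]) X = real (k + 1) * \<Delta>" if "\<omega> \<in> space M" for \<omega>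
    proof -
      have "finite (A \<omega> V d [P])" "A \<omega> V d [P] \<noteq> {}"
        using out[OF that] P(1) assms(1) by (auto intro: finite_subset)
      then have "Cost d X (A \<omega> V d [P]) = real (card X) * \<Delta>"
        unfolding d_def using out[OF that] X(3)
        by (intro Cost_two_cluster_dist_far) (auto simp: d_def)
      then show ?thesis
        using opt X(2) by (simp add: rho_def)
    qed
    \<comment> \<open>The ratio is the same for every seed, so randomization does not help: the
      expectation is that constant.\<close>
    then have "expectation (\<lambda>\<omega>. rho k V d (A \<omega> V d [P]) X) = expectation (\<lambda>\<omega>. real (k + 1) * \<Delta>)"
      by (intro Bochner_Integration.integral_cong) auto
    moreover have "rho k V d (X - {x}) X = 1"
      unfolding rho_def opt unfolding d_def
      using Cost_two_cluster_dist_remove[OF \<Delta> X(1,3) px(2) Y_ne] by simp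
    ultimately show ?thesis
      using le by (simp add: prob_space)
  qed
  \<comment> \<open>The threshold 1 is enough: it gives \<open>h k \<Delta> < k * \<Delta>\<close>,
    while the lower bound carries one more \<open>\<Delta>\<close>, which absorbs \<open>c\<close>
    as soon as \<open>c \<le> \<Delta>\<close>. Since \<open>1 \<le> c\<close>, such a
    \<open>\<Delta>\<close> is also admissible in \<open>lower\<close>.\<close>
  have "\<forall>\<^sub>F \<Delta> in at_top. h k \<Delta> / (real k * \<Delta>) < 1"
    using lim by (rule order_tendstoD) simp
  moreover have "\<forall>\<^sub>F \<Delta> in at_top. c \<le> (\<Delta> :: real)"
    by (rule eventually_ge_at_top)
  ultimately have "\<forall>\<^sub>F \<Delta> in at_top. h k \<Delta> / (real k * \<Delta>) < 1 \<and> c \<le> (\<Delta> :: real)"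
    by (rule eventually_conj)
  then obtain \<Delta> where \<Delta>: "h k \<Delta> / (real k * \<Delta>) < 1" "c \<le> \<Delta>"
    using eventually_happens' trivial_limit_at_top_linorder by blast
  then have "h k \<Delta> < real k * \<Delta>"
    using assms(1,2) by (simp add: divide_less_eq split: if_splits)
  moreover have "real k * \<Delta> + \<Delta> - c \<le> h k \<Delta>"
    using lower[of \<Delta>] \<Delta>(2) assms(2) by (simp add: algebra_simps)
  ultimately show False
    using \<Delta>(2) by simp
qed

end
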